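(* $$\lim_{n\to\infty}\frac{\Pi_n}{c_n}=1.$$
   Context: $\mathbb{M}$ is the free magma on one generator $1$ (its elements are identified with finite full binary trees), with operation $+$. The length $\ell:\mathbb{M}\to\mathbb{N}$ is defined by $\ell(1)=1$, $\ell(x+y)=\ell(x)+\ell(y)$. The product on $\mathbb{M}$ is the unique operation with $x\cdot1=1\cdot x=x$ and $x\cdot(y+z)=x\cdot y+x\cdot z$. An element $a$ divides $x$ iff $x=ay$ for some $y\in\mathbb{M}$. An element $x\neq1$ is prime iff its only divisors are $1$ and $x$. $\Pi_n$ denotes the number of prime elements of $\mathbb{M}$ of length $n$. $c_n=C_{n-1}$, where $C_m=\frac1{m+1}\binom{2m}{m}$ is the $m$-th Catalan number; $c_n$ is the number of elements of $\mathbb{M}$ of length $n$. *)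

theory Defs imports Complex_Main begin

datatype free_magma = Leaf | Node free_magma free_magma

text \<open>
  The product recurses on its right argument and is not commutative. In class \<^class>\<open>Rings.dvd\<close>,
  \<open>a dvd x\<close> means \<open>\<exists>y. x = a * y\<close>, so \<open>a\<close> is a left factor of \<open>x\<close>.
\<close>

instantiation free_magma :: "{one, plus, Rings.dvd}"
begin

definition one_free_magma :: free_magma where
  "1 = Leaf"

definition plus_free_magma :: "free_magma \<Rightarrow> free_magma \<Rightarrow> free_magma" where
  "x + y = Node x y"

primrec times_free_magma :: "free_magma \<Rightarrow> free_magma \<Rightarrow> free_magma" where
  "x * Leaf = x"
| "x * Node y z = x * y + x * z"

instance ..

end

primrec len :: "free_magma \<Rightarrow> nat" where
  "len Leaf = 1"
| "len (Node x y) = len x + len y"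

lemma len_one: "len 1 = 1"
  by (simp add: one_free_magma_def)

lemma len_plus: "len (x + y) = len x + len y"
  by (simp add: plus_free_magma_def)

lemma free_magma_mult_1_right: "x * 1 = (x :: free_magma)"
  by (simp add: one_free_magma_def)

lemma free_magma_mult_1_left: "1 * x = (x :: free_magma)"
  by (induction x) (simp_all add: one_free_magma_def plus_free_magma_def)

lemma free_magma_distrib_left: "x * (y + z) = x * y + x * (z :: free_magma)"
  by (simp add: plus_free_magma_def)

definition magma_prime :: "free_magma \<Rightarrow> bool" where
  "magma_prime x \<longleftrightarrow> x \<noteq> 1 \<and> (\<forall>a. a dvd x \<longrightarrow> a = 1 \<or> a = x)"

definition num_primes :: "nat \<Rightarrow> nat" where
  "num_primes n = card {x. magma_prime x \<and> len x = n}"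

lemma len_pos: "len x > 0"
  by (induction x) auto

lemma finite_len_le: "finite {x. len x \<le> n}"
proof (induction n)
  case 0
  have "len x \<noteq> 0" for x
    using len_pos[of x] by simp
  show ?case by (simp add: \<open>\<And>x. len x \<noteq> 0\<close>)
next
  case (Suc n)
  have "x \<in> insert Leaf ((\<lambda>(y, z). Node y z) ` ({x. len x \<le> n} \<times> {x. len x \<le> n}))"
    if "len x \<le> Suc n" for x
  proof (cases x)
    case (Node y z)
    then have "len y \<le> n" "len z \<le> n"
      using that len_pos[of y] len_pos[of z] by auto
    then show ?thesis using Node by auto
  qed simp
  then have "{x. len x \<le> Suc n} \<subseteq>
      insert Leaf ((\<lambda>(y, z). Node y z) ` ({x. len x \<le> n} \<times> {x. len x \<le> n}))"
    by blast
  then show ?case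
    by (rule finite_subset) (use Suc.IH in simp)
qed

lemma finite_len_eq: "finite {x. len x = n}"
  by (rule finite_subset[OF _ finite_len_le[of n]]) auto

lemma finite_primes_len: "finite {x. magma_prime x \<and> len x = n}"
  by (rule finite_subset[OF _ finite_len_eq[of n]]) auto

definition catalan :: "nat \<Rightarrow> real" where
  "catalan m = 1 / (real m + 1) * real ((2 * m) choose m)"

text \<open>Only \<open>n \<ge> 1\<close> is meaningful; by truncated subtraction \<open>c 0 = catalan 0\<close>.\<close>

definition c :: "nat \<Rightarrow> real" where
  "c n = catalan (n - 1)"

end

(*
  Lengths multiply, so a composite element of length n is a product of elements of lengths d and e
  with d e = n and d, e >= 2. Then d + e <= n/2 + 2, and since there are at most 4^(k-1) elements
  of length k, there are at most n 2^n composites of length n. This is negligible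
  against c_n >= 4^(n-1) / (2 n^2).
*)

theory Submission
  imports Defs "HOL-Real_Asymp.Real_Asymp"
begin

section \<open>Catalan numbers: recurrences and bounds of order 4^n\<close>

lemma catalan_pos: "catalan n > 0"
  by (simp add: catalan_def)

lemma catalan_0: "catalan 0 = 1"
  by (simp add: catalan_def)

text \<open>Absorption links row 2n+1 to row 2n; Pascal's rule and the symmetry of row 2n+1 make the
  central entry of row 2n+2 twice its neighbour above.\<close>

lemma catalan_Suc: "(real n + 2) * catalan (Suc n) = (4 * real n + 2) * catalan n"
proof -
  have "real (Suc n) * real (Suc (2 * n) choose Suc n) = real (Suc (2 * n)) * real ((2 * n) choose n)"
    by (simp only: Suc_times_binomial flip: of_nat_mult)
  moreover have "(2 * Suc n) choose Suc n = 2 * (Suc (2 * n) choose Suc n)"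
    using binomial_symmetric[of n "Suc (2 * n)"] by simp
  ultimately have "(real n + 1) * real ((2 * Suc n) choose Suc n) =
      (4 * real n + 2) * real ((2 * n) choose n)"
    by (simp add: algebra_simps del: binomial_Suc_Suc)
  then show ?thesis
    unfolding catalan_def by (simp add: field_simps del: binomial_Suc_Suc mult_Suc_right)
qed

text \<open>The reflection \<open>k\<close> to \<open>n - k\<close> fixes the products and exchanges
  the weights \<open>k\<close> and \<open>n - k\<close>, whose sum is \<open>n\<close>.\<close>

lemma sum_index_weighted_convolution:
  fixes f :: "nat \<Rightarrow> real"
  shows "2 * (\<Sum>k\<le>n. real k * (f k * f (n - k))) = real n * (\<Sum>k\<le>n. f k * f (n - k))"
proof -
  have "(\<Sum>k\<le>n. real k * (f k * f (n - k))) = (\<Sum>k\<le>n. real (n - k) * (f k * f (n - k)))"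
    by (rule sum.reindex_bij_witness[of _ "\<lambda>k. n - k" "\<lambda>k. n - k"]) (auto simp: mult.commute)
  then have "2 * (\<Sum>k\<le>n. real k * (f k * f (n - k))) =
      (\<Sum>k\<le>n. real k * (f k * f (n - k)) + real (n - k) * (f k * f (n - k)))"
    by (simp add: sum.distrib)
  also have "\<dots> = (\<Sum>k\<le>n. real n * (f k * f (n - k)))"
    by (intro sum.cong) (auto simp: of_nat_diff algebra_simps)
  finally show ?thesis
    by (simp add: sum_distrib_left)
qed

text \<open>
  Computing the index-weighted convolution of length \<open>n + 1\<close> once by symmetry and once by the
  first-order recurrence for \<open>catalan\<close> gives a first-order recurrence for the convolutions.
\<close>

lemma catalan_convolution: "(\<Sum>k\<le>n. catalan k * catalan (n - k)) = catalan (Suc n)"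
proof (induction n)
  case 0
  then show ?case
    using catalan_Suc[of 0] by (simp add: catalan_0)
next
  case (Suc n)
  define S where "S m = (\<Sum>k\<le>m. catalan k * catalan (m - k))" for m
  define T where "T m = (\<Sum>k\<le>m. real k * (catalan k * catalan (m - k)))" for m
  have T: "2 * T m = real m * S m" for m
    unfolding S_def T_def by (rule sum_index_weighted_convolution)
  \<comment> \<open>Adding \<open>S\<close> raises the weight to \<open>k + 1\<close>; splitting off
    \<open>k = 0\<close> and shifting turns it into \<open>k + 2\<close>, the left factor in
    \<open>catalan_Suc\<close>.\<close>
  have "T (Suc n) + S (Suc n) =
      (\<Sum>k\<le>Suc n. (real k + 1) * catalan k * catalan (Suc n - k))"
    unfolding S_def T_def sum.distrib[symmetric] by (intro sum.cong) (simp_all add: algebra_simps)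
  also have "\<dots> = catalan (Suc n) +
      (\<Sum>k\<le>n. (real k + 2) * catalan (Suc k) * catalan (n - k))"
    by (subst sum.atMost_Suc_shift) (simp add: catalan_0 add_ac)
  also have "\<dots> = catalan (Suc n) + (\<Sum>k\<le>n. (4 * real k + 2) * catalan k * catalan (n - k))"
    by (simp only: catalan_Suc)
  also have "(\<Sum>k\<le>n. (4 * real k + 2) * catalan k * catalan (n - k)) = 4 * T n + 2 * S n"
    unfolding S_def T_def sum_distrib_left sum.distrib[symmetric]
    by (intro sum.cong) (simp_all add: algebra_simps)
  \<comment> \<open>Doubling the identity allows both values of \<open>T\<close> to be eliminated
    through \<open>T\<close>.\<close>
  finally have "(real n + 3) * S (Suc n) = 2 * catalan (Suc n) + 4 * (real n + 1) * S n"
    using T[of n] T[of "Suc n"] by (simp add: algebra_simps)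
  moreover have "S n = catalan (Suc n)"
    using Suc by (simp add: S_def)
  ultimately have "(real n + 3) * S (Suc n) = (real n + 3) * catalan (Suc (Suc n))"
    using catalan_Suc[of "Suc n"] by (simp add: algebra_simps)
  then show ?case
    unfolding S_def by simp
qed

lemma catalan_le: "catalan n \<le> 4 ^ n"
proof -
  have "(2 * n) choose n \<le> 2 ^ (2 * n)"
    by (rule binomial_le_pow2)
  then have "(2 * n) choose n \<le> 4 ^ n"
    by (simp add: power_mult)
  then have "real ((2 * n) choose n) \<le> real (4 ^ n)"
    by (simp only: of_nat_le_iff)
  then have "1 / (real n + 1) * real ((2 * n) choose n) \<le> 1 * 4 ^ n"
    by (intro mult_mono) auto
  then show ?thesis
    by (simp add: catalan_def)
qed

lemma catalan_ge: "4 ^ n / (2 * (real n + 1) ^ 2) \<le> catalan n"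
proof -
  \<comment> \<open>The standard bound 4^n / (2n) is for positive n; the larger denominator also
    covers n = 0.\<close>
  have "4 ^ n / (2 * (real n + 1)) \<le> real ((2 * n) choose n)"
  proof (cases "n = 0")
    case False
    then have "4 ^ n / (2 * (real n + 1)) \<le> 4 ^ n / (2 * real n)"
      by (intro divide_left_mono) auto
    with False show ?thesis
      using central_binomial_lower_bound[of n] by simp
  qed simp
  then have "1 / (real n + 1) * (4 ^ n / (2 * (real n + 1))) \<le> catalan n"
    unfolding catalan_def by (intro mult_left_mono) auto
  then show ?thesis
    by (simp add: power2_eq_square algebra_simps)
qed

section \<open>Lengths and the number of elements of each length\<close>

lemma len_eq_1_iff: "len x = 1 \<longleftrightarrow> x = 1"
proof (cases x)
  case (Node y z)
  then show ?thesis
    using len_pos[of y] len_pos[of z] by (simp add: one_free_magma_def)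
qed (simp add: one_free_magma_def)

lemma len_mult: "len (x * y) = len x * len y"
  by (induction y) (simp_all add: plus_free_magma_def algebra_simps)

text \<open>Every element other than a leaf splits uniquely into two subtrees. Indexing by the
  length of the left one minus 1 gives the shape of \<open>catalan_convolution\<close>.\<close>

lemma card_len_Suc_Suc:
  "card {x. len x = Suc (Suc n)} =
   (\<Sum>k\<le>n. card {x. len x = Suc k} * card {x. len x = Suc (n - k)})"
proof -
  let ?E = "\<lambda>k. {x. len x = k}"
  let ?N = "\<lambda>k. case_prod Node ` (?E (Suc k) \<times> ?E (Suc (n - k)))"
  have "?E (Suc (Suc n)) = (\<Union>k\<le>n. ?N k)"
  proof (intro equalityI subsetI)
    fix x assume "x \<in> ?E (Suc (Suc n))"
    then obtain y z where x: "x = Node y z" and *: "len y + len z = Suc (Suc n)"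
      by (cases x) auto
    have "len y - 1 \<le> n" "len y = Suc (len y - 1)" "len z = Suc (n - (len y - 1))"
      using * len_pos[of y] len_pos[of z] by auto
    then show "x \<in> (\<Union>k\<le>n. ?N k)"
      using x by blast
  qed auto
  \<comment> \<open>The pieces are disjoint because the length of the left subtree determines
    \<open>k\<close>.\<close>
  moreover have "card (\<Union>k\<le>n. ?N k) = (\<Sum>k\<le>n. card (?N k))"
    by (intro card_UN_disjoint) (auto simp: finite_len_eq)
  moreover have "card (?N k) = card (?E (Suc k)) * card (?E (Suc (n - k)))" for k
    by (subst card_image) (auto simp: inj_on_def card_cartesian_product)
  ultimately show ?thesis
    by simp
qed

text \<open>Both sides start at 1 and satisfy the same convolution recurrence, which involves all
  smaller indices; hence the strong induction.\<close>

lemma card_len_eq_catalan: "real (card {x. len x = Suc n}) = catalan n"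
proof (induction n rule: less_induct)
  case (less n)
  show ?case
  proof (cases n)
    case 0
    have "{x. len x = Suc 0} = {1}"
      using len_eq_1_iff by auto
    then show ?thesis
      using 0 by (simp add: catalan_0)
  next
    case (Suc m)
    then have "real (card {x. len x = Suc n}) = (\<Sum>k\<le>m. catalan k * catalan (m - k))"
      using less by (simp add: card_len_Suc_Suc)
    then show ?thesis
      using Suc by (simp add: catalan_convolution)
  qed
qed

lemma card_len_le:
  assumes "n > 0"
  shows "card {x. len x = n} \<le> 4 ^ (n - 1)"
proof -
  have "real (card {x. len x = n}) = catalan (n - 1)"
    using assms card_len_eq_catalan[of "n - 1"] by simp
  also have "\<dots> \<le> real (4 ^ (n - 1))"
    using catalan_le[of "n - 1"] by simp
  finally show ?thesis
    by (simp only: of_nat_le_iff)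
qed

section \<open>Counting composite elements\<close>

lemma composite_factorization:
  assumes "\<not> magma_prime x" "x \<noteq> 1"
  obtains a y where "x = a * y" "len a \<ge> 2" "len y \<ge> 2"
proof -
  from assms obtain a y where *: "x = a * y" "a \<noteq> 1" "a \<noteq> x"
    unfolding magma_prime_def dvd_def by auto
  \<comment> \<open>A cofactor 1 would force \<open>a = x\<close>. Both factors thus differ from 1,
    the only element of length 1.\<close>
  then have "y \<noteq> 1"
    using free_magma_mult_1_right by auto
  with * show ?thesis
    using that[of a y] len_eq_1_iff[of a] len_eq_1_iff[of y] len_pos[of a] len_pos[of y] by linarith
qed

lemma card_len_mult_le:
  assumes "d \<ge> 2" "e \<ge> 2" "d * e = n"
  shows "card {x. len x = d} * card {x. len x = e} \<le> 2 ^ n"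
proof -
  from assms obtain d' e' where d: "d = d' + 2" and e: "e = e' + 2"
    by (metis add.commute le_Suc_ex)
  \<comment> \<open>This is (d - 2)(e - 2) \<ge> 0 rearranged: the two sides differ by
    \<open>d' * e'\<close>.\<close>
  then have "2 * (d - 1 + (e - 1)) \<le> n"
    using assms(3) by (auto simp: algebra_simps)
  then have "(2::nat) ^ (2 * (d - 1 + (e - 1))) \<le> 2 ^ n"
    by (rule power_increasing) simp
  moreover have "(2::nat) ^ (2 * (d - 1 + (e - 1))) = 4 ^ (d - 1) * 4 ^ (e - 1)"
    by (simp add: power_mult power_add)
  moreover have "card {x. len x = d} * card {x. len x = e} \<le> 4 ^ (d - 1) * 4 ^ (e - 1)"
    using assms by (intro mult_mono card_len_le) auto
  ultimately show ?thesis
    by linarith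
qed

lemma card_composite_le:
  assumes "n \<ge> 2"
  shows "card {x. \<not> magma_prime x \<and> len x = n} \<le> n * 2 ^ n"
proof -
  let ?E = "\<lambda>k. {x. len x = k}"
  let ?P = "\<lambda>d. case_prod (*) ` (?E d \<times> ?E (n div d))"
  \<comment> \<open>The candidate lengths of the left factor; the last condition makes the division
    exact, so \<open>n div d\<close> is the length of the cofactor.\<close>
  define D where "D = {d. 2 \<le> d \<and> 2 \<le> n div d \<and> d * (n div d) = n}"
  have "D \<subseteq> {1..n}"
  proof
    fix d assume "d \<in> D"
    then have "d dvd n" "d \<ge> 1"
      unfolding D_def by (auto intro: dvdI[of n d "n div d", OF sym])
    then show "d \<in> {1..n}"
      using assms by (auto dest: dvd_imp_le)
  qed
  then have "finite D" "card D \<le> n"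
    using card_mono[of "{1..n}" D] by (auto intro: finite_subset)
  have "{x. \<not> magma_prime x \<and> len x = n} \<subseteq> (\<Union>d\<in>D. ?P d)"
  proof
    fix x assume x: "x \<in> {x. \<not> magma_prime x \<and> len x = n}"
    \<comment> \<open>The element 1 is not prime either, but it has no factorization into longer
      elements; the bound on \<open>n\<close> excludes it.\<close>
    then have "x \<noteq> 1"
      using assms len_eq_1_iff[of x] by auto
    with x obtain a y where *: "x = a * y" "len a \<ge> 2" "len y \<ge> 2"
      using composite_factorization by blast
    then have "len a * len y = n"
      using x by (simp add: len_mult)
    with * have "n div len a = len y"
      by auto
    with * \<open>len a * len y = n\<close> have "len a \<in> D" "x \<in> ?P (len a)"
      by (auto simp: D_def)
    then show "x \<in> (\<Union>d\<in>D. ?P d)"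
      by blast
  qed
  then have "card {x. \<not> magma_prime x \<and> len x = n} \<le> card (\<Union>d\<in>D. ?P d)"
    using \<open>finite D\<close> by (intro card_mono) (auto simp: finite_len_eq)
  \<comment> \<open>An element can have left factors of several lengths, so the pieces may overlap;
    the union bound suffices.\<close>
  also have "\<dots> \<le> (\<Sum>d\<in>D. card (?P d))"
    using \<open>finite D\<close> by (rule card_UN_le)
  also have "\<dots> \<le> (\<Sum>d\<in>D. 2 ^ n)"
  proof (rule sum_mono)
    fix d assume "d \<in> D"
    have "card (?P d) \<le> card (?E d \<times> ?E (n div d))"
      by (intro card_image_le) (simp add: finite_len_eq)
    also have "\<dots> \<le> 2 ^ n"
      unfolding card_cartesian_product using \<open>d \<in> D\<close>
      by (intro card_len_mult_le) (auto simp: D_def)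
    finally show "card (?P d) \<le> 2 ^ n" .
  qed
  also have "\<dots> \<le> n * 2 ^ n"
    using \<open>card D \<le> n\<close> by simp
  finally show ?thesis .
qed

section \<open>The density of primes\<close>

lemma num_primes_plus_composites:
  assumes "n \<ge> 1"
  shows "real (num_primes n) + real (card {x. \<not> magma_prime x \<and> len x = n}) = c n"
proof -
  have "finite {x. \<not> magma_prime x \<and> len x = n}"
    by (rule finite_subset[OF _ finite_len_eq[of n]]) auto
  then have "card ({x. magma_prime x \<and> len x = n} \<union> {x. \<not> magma_prime x \<and> len x = n}) =
      num_primes n + card {x. \<not> magma_prime x \<and> len x = n}"
    unfolding num_primes_def by (intro card_Un_disjoint finite_primes_len) auto
  moreover have "{x. magma_prime x \<and> len x = n} \<union> {x. \<not> magma_prime x \<and> len x = n} = {x. len x = n}"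
    by auto
  \<comment> \<open>Here \<open>n \<ge> 1\<close> matters: \<open>c 0\<close> is 1, while no element
    has length 0.\<close>
  moreover have "real (card {x. len x = n}) = c n"
    using assms card_len_eq_catalan[of "n - 1"] by (simp add: c_def)
  ultimately show ?thesis
    by simp
qed

theorem proposition3p7:
  "(\<lambda>n. real (num_primes n) / c n) \<longlonglongrightarrow> 1"
proof (rule tendsto_sandwich[OF _ _ _ tendsto_const])
  \<comment> \<open>The error term is the composite bound n 2^n divided by the lower bound 4^n / (8
    n^2) for \<open>c n\<close>.\<close>
  have bounds: "1 - 8 * real n ^ 3 / 2 ^ n \<le> real (num_primes n) / c n \<and>
      real (num_primes n) / c n \<le> 1" if "n \<ge> 2" for n
  proof -
    let ?q = "real (card {x. \<not> magma_prime x \<and> len x = n})"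
    have pos: "c n > 0"
      by (simp add: c_def catalan_pos)
    have ratio: "real (num_primes n) / c n = 1 - ?q / c n"
      using num_primes_plus_composites[of n] that pos by (simp add: field_simps)
    have "?q \<le> real (n * 2 ^ n)"
      using card_composite_le[OF that] by (simp only: of_nat_le_iff)
    \<comment> \<open>The index shift in \<open>c\<close> turns 4^(n-1) into 4^n / 4, so the
      constant 2 of \<open>catalan_ge\<close> becomes 8.\<close>
    moreover have "4 ^ n / (8 * real n ^ 2) \<le> c n"
    proof -
      have "n = Suc (n - 1)"
        using that by simp
      then show ?thesis
        using catalan_ge[of "n - 1"] by (cases n) (auto simp: c_def add.commute)
    qed
    ultimately have "?q / c n \<le> real (n * 2 ^ n) / (4 ^ n / (8 * real n ^ 2))"
      using that by (intro frac_le) auto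
    also have "(4::real) ^ n = 2 ^ n * 2 ^ n"
      by (simp flip: power_mult_distrib)
    also have "real (n * 2 ^ n) / (2 ^ n * 2 ^ n / (8 * real n ^ 2)) = 8 * real n ^ 3 / 2 ^ n"
      by (simp add: field_simps power2_eq_square power3_eq_cube)
    finally show ?thesis
      using ratio pos by simp
  qed
  show "\<forall>\<^sub>F n in sequentially. 1 - 8 * real n ^ 3 / 2 ^ n \<le> real (num_primes n) / c n"
    "\<forall>\<^sub>F n in sequentially. real (num_primes n) / c n \<le> 1"
    using bounds by (auto intro: eventually_sequentiallyI[of 2])
  show "(\<lambda>n. 1 - 8 * real n ^ 3 / 2 ^ n) \<longlonglongrightarrow> 1"
    by real_asymp
qed

end
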